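(* There is a reflexive subspace of $L_1[0,1]$ (with its usual norm $\|\cdot\|_1$) that fails normal structure.
   Context: $L_1[0,1]$ is the Banach space of (equivalence classes modulo a.e. equality of) Lebesgue integrable scalar functions on $[0,1]$ with norm $\|f\|_1=\int_0^1|f|$. "Subspace" means closed linear subspace. For a closed, bounded, convex subset $C$ of a Banach space $(X,\|\cdot\|_X)$ and $x\in C$, put $\mathrm{rad}(x;C):=\sup_{y\in C}\|x-y\|_X$, $\mathrm{rad}(C):=\inf_{x\in C}\mathrm{rad}(x;C)$ and $\mathrm{diam}(C):=\sup_{x\in C}\mathrm{rad}(x;C)$. The space $X$ has normal structure if every closed, bounded, convex subset $C$ of $X$ containing at least two points satisfies $\mathrm{rad}(C)<\mathrm{diam}(C)$. *)

theory Defs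
  imports "HOL-Analysis.Analysis" "HOL-Library.Function_Algebras"
begin

section \<open>The Banach space of integrable functions on the unit interval\<close>

abbreviation unit_leb :: "real measure"
  where "unit_leb \<equiv> lebesgue_on {0..1}"

definition L1_rel :: "(real \<Rightarrow> 'a::{banach,second_countable_topology}) \<Rightarrow> (real \<Rightarrow> 'a) \<Rightarrow> bool"
  where "L1_rel f g \<longleftrightarrow>
    integrable unit_leb f \<and> integrable unit_leb g \<and> (AE x in unit_leb. f x = g x)"

lemma L1_rel_part_equivp: "part_equivp L1_rel"
proof (rule part_equivpI)
  show "\<exists>f::real \<Rightarrow> 'a. L1_rel f f"
    by (rule exI[of _ "\<lambda>_. 0"]) (simp add: L1_rel_def)
  show "symp (L1_rel :: (real \<Rightarrow> 'a) \<Rightarrow> _)"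
    by (auto simp: symp_def L1_rel_def)
  show "transp (L1_rel :: (real \<Rightarrow> 'a) \<Rightarrow> _)"
    unfolding transp_def L1_rel_def by (auto elim: AE_mp)
qed

quotient_type (overloaded) 'a L1 =
  "real \<Rightarrow> 'a::{banach,second_countable_topology}" / partial: L1_rel
  by (rule L1_rel_part_equivp)

instantiation L1 :: ("{banach,second_countable_topology}") real_normed_vector
begin

lift_definition zero_L1 :: "'a L1" is "\<lambda>_. 0"
  by (simp add: L1_rel_def)

lift_definition plus_L1 :: "'a L1 \<Rightarrow> 'a L1 \<Rightarrow> 'a L1" is "\<lambda>f g x. f x + g x"
  unfolding L1_rel_def by (auto elim: AE_mp)

lift_definition minus_L1 :: "'a L1 \<Rightarrow> 'a L1 \<Rightarrow> 'a L1" is "\<lambda>f g x. f x - g x"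
  unfolding L1_rel_def by (auto elim: AE_mp)

lift_definition uminus_L1 :: "'a L1 \<Rightarrow> 'a L1" is "\<lambda>f x. - f x"
  unfolding L1_rel_def by (auto elim: AE_mp)

lift_definition scaleR_L1 :: "real \<Rightarrow> 'a L1 \<Rightarrow> 'a L1" is "\<lambda>c f x. c *\<^sub>R f x"
  unfolding L1_rel_def by (auto elim: AE_mp)

lift_definition norm_L1 :: "'a L1 \<Rightarrow> real" is "\<lambda>f. \<integral>x. norm (f x) \<partial>unit_leb"
  unfolding L1_rel_def by (rule integral_cong_AE) (auto elim: AE_mp)

definition dist_L1 :: "'a L1 \<Rightarrow> 'a L1 \<Rightarrow> real"
  where "dist_L1 f g = norm (f - g)"

definition sgn_L1 :: "'a L1 \<Rightarrow> 'a L1"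
  where "sgn_L1 f = inverse (norm f) *\<^sub>R f"

definition uniformity_L1 :: "('a L1 \<times> 'a L1) filter"
  where "uniformity_L1 = (INF e\<in>{0<..}. principal {(f, g). dist f g < e})"

definition open_L1 :: "'a L1 set \<Rightarrow> bool"
  where "open_L1 U \<longleftrightarrow> (\<forall>f\<in>U. eventually (\<lambda>(f', g). f' = f \<longrightarrow> g \<in> U) uniformity)"

instance
proof
  fix f g h :: "'a L1" and a b :: real
  show "f + g + h = f + (g + h)"
    by transfer (auto simp: L1_rel_def add.assoc)
  show "f + g = g + f"
    by transfer (auto simp: L1_rel_def add.commute)
  show "0 + f = f"
    by transfer (auto simp: L1_rel_def)
  show "- f + f = 0"
    by transfer (auto simp: L1_rel_def)
  show "f - g = f + - g"
    by transfer (auto simp: L1_rel_def)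
  show "a *\<^sub>R (f + g) = a *\<^sub>R f + a *\<^sub>R g"
    by transfer (auto simp: L1_rel_def scaleR_add_right)
  show "(a + b) *\<^sub>R f = a *\<^sub>R f + b *\<^sub>R f"
    by transfer (auto simp: L1_rel_def scaleR_add_left)
  show "a *\<^sub>R b *\<^sub>R f = (a * b) *\<^sub>R f"
    by transfer (auto simp: L1_rel_def)
  show "1 *\<^sub>R f = f"
    by transfer (auto simp: L1_rel_def)
  show "dist f g = norm (f - g)"
    by (rule dist_L1_def)
  show "sgn f = inverse (norm f) *\<^sub>R f"
    by (rule sgn_L1_def)
  show "uniformity = (INF e\<in>{0<..}. principal {(f, g :: 'a L1). dist f g < e})"
    by (rule uniformity_L1_def)
  show "open U \<longleftrightarrow> (\<forall>f\<in>U. eventually (\<lambda>(f', g). f' = f \<longrightarrow> g \<in> U) uniformity)"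
    for U :: "'a L1 set"
    by (rule open_L1_def)
  show "norm f = 0 \<longleftrightarrow> f = 0"
  proof transfer
    fix f :: "real \<Rightarrow> 'a" assume "L1_rel f f"
    then have f: "integrable unit_leb f" by (simp add: L1_rel_def)
    then have "(\<integral>x. norm (f x) \<partial>unit_leb) = 0 \<longleftrightarrow> (AE x in unit_leb. norm (f x) = 0)"
      by (intro integral_nonneg_eq_0_iff_AE) auto
    then show "(\<integral>x. norm (f x) \<partial>unit_leb) = 0 \<longleftrightarrow> L1_rel f (\<lambda>_. 0)"
      using f by (simp add: L1_rel_def)
  qed
  show "norm (f + g) \<le> norm f + norm g"
  proof transfer
    fix f g :: "real \<Rightarrow> 'a" assume "L1_rel f f" "L1_rel g g"
    then have fg: "integrable unit_leb f" "integrable unit_leb g" by (simp_all add: L1_rel_def)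
    have "(\<integral>x. norm (f x + g x) \<partial>unit_leb) \<le> (\<integral>x. norm (f x) + norm (g x) \<partial>unit_leb)"
      using fg by (intro integral_mono) (auto intro: norm_triangle_ineq)
    then show "(\<integral>x. norm (f x + g x) \<partial>unit_leb)
        \<le> (\<integral>x. norm (f x) \<partial>unit_leb) + (\<integral>x. norm (g x) \<partial>unit_leb)"
      using fg by simp
  qed
  show "norm (a *\<^sub>R f) = \<bar>a\<bar> * norm f"
    by transfer simp
qed

end

text \<open>Scalars are the values of the functions, so for complex functions the subspaces and
  functionals below are complex linear.\<close>

lift_definition scaleK ::
  "'k::{real_normed_field,banach,second_countable_topology} \<Rightarrow> 'k L1 \<Rightarrow> 'k L1"
  is "\<lambda>c f x. c * f x"
  unfolding L1_rel_def by (auto elim: AE_mp)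

interpretation L1: vector_space scaleK
proof
  fix a b :: 'a and f g :: "'a L1"
  show "scaleK a (f + g) = scaleK a f + scaleK a g"
    by transfer (auto simp: L1_rel_def distrib_left)
  show "scaleK (a + b) f = scaleK a f + scaleK b f"
    by transfer (auto simp: L1_rel_def distrib_right)
  show "scaleK a (scaleK b f) = scaleK (a * b) f"
    by transfer (auto simp: L1_rel_def mult.assoc)
  show "scaleK 1 f = f"
    by transfer (auto simp: L1_rel_def)
qed

lemma scaleK_of_real: "scaleK (of_real c) f = c *\<^sub>R f"
  by transfer (auto simp: L1_rel_def scaleR_conv_of_real)

lemma norm_scaleK: "norm (scaleK c f) = norm c * norm f"
  by transfer (simp add: norm_mult)

section \<open>Reflexivity\<close>

text \<open>A normed space over \<open>'k\<close> is given by a carrier \<open>V\<close>, a scalar multiplication \<open>s\<close> and a norm \<open>N\<close>.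
  Functionals on \<open>V\<close> vanish off \<open>V\<close>, so that equal functionals are equal as functions. The dual is
  again a normed space of this form, with pointwise operations.\<close>

definition dual_space ::
  "('k::real_normed_field \<Rightarrow> 'v::ab_group_add \<Rightarrow> 'v) \<Rightarrow> ('v \<Rightarrow> real) \<Rightarrow> 'v set \<Rightarrow> ('v \<Rightarrow> 'k) set"
  where "dual_space s N V = {\<phi>.
    (\<forall>x\<in>V. \<forall>y\<in>V. \<phi> (x + y) = \<phi> x + \<phi> y) \<and>
    (\<forall>c. \<forall>x\<in>V. \<phi> (s c x) = c * \<phi> x) \<and>
    (\<exists>B. \<forall>x\<in>V. norm (\<phi> x) \<le> B * N x) \<and>
    (\<forall>x. x \<notin> V \<longrightarrow> \<phi> x = 0)}"

definition dual_norm :: "('v \<Rightarrow> real) \<Rightarrow> 'v set \<Rightarrow> ('v \<Rightarrow> 'k::real_normed_field) \<Rightarrow> real"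
  where "dual_norm N V \<phi> = (SUP x\<in>{x\<in>V. N x \<le> 1}. norm (\<phi> x))"

definition dual_scale :: "'k::real_normed_field \<Rightarrow> ('v \<Rightarrow> 'k) \<Rightarrow> 'v \<Rightarrow> 'k"
  where "dual_scale c \<phi> = (\<lambda>x. c * \<phi> x)"

definition bidual_space ::
  "('k::real_normed_field \<Rightarrow> 'v::ab_group_add \<Rightarrow> 'v) \<Rightarrow> ('v \<Rightarrow> real) \<Rightarrow> 'v set \<Rightarrow> (('v \<Rightarrow> 'k) \<Rightarrow> 'k) set"
  where "bidual_space s N V = dual_space dual_scale (dual_norm N V) (dual_space s N V)"

definition reflexive_space ::
  "('k::real_normed_field \<Rightarrow> 'v::ab_group_add \<Rightarrow> 'v) \<Rightarrow> ('v \<Rightarrow> real) \<Rightarrow> 'v set \<Rightarrow> bool"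
  where "reflexive_space s N V \<longleftrightarrow>
    (\<forall>\<Phi>\<in>bidual_space s N V. \<exists>x\<in>V. \<forall>\<phi>\<in>dual_space s N V. \<Phi> \<phi> = \<phi> x)"

section \<open>Normal structure\<close>

definition rad_at :: "'v::real_normed_vector \<Rightarrow> 'v set \<Rightarrow> real"
  where "rad_at x C = (SUP y\<in>C. norm (x - y))"

definition rad :: "'v::real_normed_vector set \<Rightarrow> real"
  where "rad C = (INF x\<in>C. rad_at x C)"

definition diam :: "'v::real_normed_vector set \<Rightarrow> real"
  where "diam C = (SUP x\<in>C. rad_at x C)"

definition normal_structure :: "'v::real_normed_vector set \<Rightarrow> bool"
  where "normal_structure X \<longleftrightarrow>
    (\<forall>C. closedin (top_of_set X) C \<and> bounded C \<and> convex C \<and> (\<exists>x\<in>C. \<exists>y\<in>C. x \<noteq> y)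
      \<longrightarrow> rad C < diam C)"

end

theory Submission
  imports Defs
begin

text \<open>The subspace is the closed linear span of the Rademacher functions \<open>r\<^sub>n\<close>. By Khintchine's
  inequality the norms of \<open>L\<^sub>1\<close> and \<open>L\<^sub>2\<close> are equivalent on it, so it is isomorphic to \<open>\<ell>\<^sub>2\<close> and
  hence reflexive. Let \<open>C\<close> be the closed convex hull of the \<open>r\<^sub>n\<close>. As \<open>\<parallel>r\<^sub>m - r\<^sub>n\<parallel> = 1\<close> for \<open>m \<noteq> n\<close>, the
  diameter of \<open>C\<close> is at most \<open>1\<close>. On the other hand, pairing \<open>x - r\<^sub>n\<close> with \<open>r\<^sub>n\<close> gives
  \<open>\<parallel>x - r\<^sub>n\<parallel> \<ge> \<bar>\<langle>x, r\<^sub>n\<rangle> - 1\<bar> \<longlonglongrightarrow> 1\<close> for each \<open>x\<close> in the subspace, so no point of \<open>C\<close> has radius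
  smaller than \<open>1\<close>.\<close>

section \<open>Sequences equivalent to the unit vectors of \<open>\<ell>\<^sub>2\<close>\<close>

lemma sum_fun_apply: "(\<Sum>i\<in>I. f i) x = (\<Sum>i\<in>I. f i x)"
  for f :: "'i \<Rightarrow> 'a \<Rightarrow> 'b::comm_monoid_add"
  by (induction I rule: infinite_finite_induct) auto

text \<open>Converse of Cauchy-Schwarz: testing with the conjugate of \<open>a\<close> bounds the
  square of the norm by \<open>D\<close> times the norm. It turns the boundedness of a functional
  into a bound on the square sums of its values.\<close>

lemma L2_set_le_of_bounded_pairing:
  fixes a :: "nat \<Rightarrow> 'k::real_normed_field"
  assumes "\<And>c. norm (\<Sum>n\<in>I. c n * a n) \<le> D * L2_set (\<lambda>n. norm (c n)) I" and "0 \<le> D"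
  shows "L2_set (\<lambda>n. norm (a n)) I \<le> D"
proof -
  let ?T = "L2_set (\<lambda>n. norm (a n)) I"
  \<comment> \<open>\<open>c\<close> plays the role of the complex conjugate of \<open>a\<close>.\<close>
  define c where "c n = of_real ((norm (a n))\<^sup>2) / a n" for n
  \<comment> \<open>Where \<open>a n = 0\<close>, division by zero gives \<open>c n = 0\<close>, so
    the equality holds there as well.\<close>
  have "norm (c n) = norm (a n)" for n
    unfolding c_def norm_divide norm_of_real by (simp add: power2_eq_square)
  moreover have "norm (\<Sum>n\<in>I. c n * a n) = ?T * ?T"
  proof -
    have "c n * a n = of_real ((norm (a n))\<^sup>2)" for n
      by (simp add: c_def)
    then have "(\<Sum>n\<in>I. c n * a n) = of_real (\<Sum>n\<in>I. (norm (a n))\<^sup>2)"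
      by (simp only: of_real_sum)
    then show ?thesis
      by (simp only: norm_of_real) (simp add: L2_set_def sum_nonneg)
  qed
  ultimately have "?T * ?T \<le> D * ?T"
    using assms(1)[of c] by simp
  then show ?thesis
    using assms(2) L2_set_nonneg[of _ I] by (cases "?T = 0") (auto simp: mult_le_cancel_right)
qed

lemma sum_mult_norm_le_L2_set:
  fixes a b :: "nat \<Rightarrow> 'k::real_normed_field"
  shows "norm (\<Sum>n\<in>I. a n * b n) \<le> L2_set (\<lambda>n. norm (a n)) I * L2_set (\<lambda>n. norm (b n)) I"
proof -
  have "norm (\<Sum>n\<in>I. a n * b n) \<le> (\<Sum>n\<in>I. \<bar>norm (a n)\<bar> * \<bar>norm (b n)\<bar>)"
    by (rule order_trans[OF norm_sum]) (simp add: norm_mult)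
  then show ?thesis
    using L2_set_mult_ineq[of "\<lambda>n. norm (a n)" "\<lambda>n. norm (b n)" I] by linarith
qed

text \<open>Bounded partial sums make the series of squares converge; its Cauchy criterion, used at
  \<epsilon> squared, controls all blocks beyond \<open>N\<close> at once.\<close>

lemma L2_set_tail_small:
  fixes f :: "nat \<Rightarrow> real"
  assumes "\<And>N. L2_set f {..<N} \<le> D" "0 < \<epsilon>"
  obtains N where "\<And>M m. N \<le> m \<Longrightarrow> L2_set f {m..<M} < \<epsilon>"
proof -
  have "summable (\<lambda>n. (f n)\<^sup>2)"
  proof (rule summableI_nonneg_bounded)
    show "(\<Sum>n<N. (f n)\<^sup>2) \<le> D\<^sup>2" for N
      using assms(1)[of N] unfolding L2_set_def by (simp add: real_le_rsqrt sqrt_le_D)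
  qed simp
  then obtain N where N: "\<And>m M. N \<le> m \<Longrightarrow> norm (\<Sum>n=m..<M. (f n)\<^sup>2) < \<epsilon>\<^sup>2"
    using \<open>0 < \<epsilon>\<close> unfolding summable_Cauchy by (meson zero_less_power)
  have "L2_set f {m..<M} < \<epsilon>" if "N \<le> m" for m M
    using N[OF that, of M] \<open>0 < \<epsilon>\<close> unfolding L2_set_def
    by (simp add: real_less_lsqrt sum_nonneg)
  then show ?thesis by (rule that)
qed

text \<open>What the argument uses of the Rademacher functions: a sequence \<open>e\<close> with
  biorthogonal functionals \<open>coord\<close> of norm at most 1 on the whole space, and a
  two-sided comparison of finite combinations with their square norm. Completeness is stated for
  sequences because the type is only a \<open>real_normed_vector\<close>.\<close>

locale l2_sequence = vector_space s
  for s :: "'k::real_normed_field \<Rightarrow> 'v::real_normed_vector \<Rightarrow> 'v" +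
  fixes e :: "nat \<Rightarrow> 'v" and coord :: "nat \<Rightarrow> 'v \<Rightarrow> 'k" and K :: real
  assumes norm_s: "norm (s c x) = norm c * norm x"
    and coord_add: "coord n (x + y) = coord n x + coord n y"
    and coord_s: "coord n (s c x) = c * coord n x"
    and coord_le: "norm (coord n x) \<le> norm x"
    and coord_e: "coord n (e m) = (if n = m then 1 else 0)"
    and upper: "norm (\<Sum>n<N. s (a n) (e n)) \<le> L2_set (\<lambda>n. norm (a n)) {..<N}"
    and lower: "L2_set (\<lambda>n. norm (a n)) {..<N} \<le> K * norm (\<Sum>n<N. s (a n) (e n))"
    and K_nonneg: "0 \<le> K"
    and complete: "Cauchy X \<Longrightarrow> convergent (X :: nat \<Rightarrow> 'v)"
begin

section \<open>The closed span and coordinate expansions\<close>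

definition closed_span :: "'v set"
  where "closed_span = closure (span (range e))"

text \<open>Padding the coefficients with zeros reduces \<open>I\<close> to an initial segment.
  Convergence of series needs this for the blocks \<open>{m..<M}\<close>.\<close>

lemma norm_sum_le_L2_set:
  assumes "finite I"
  shows "norm (\<Sum>n\<in>I. s (a n) (e n)) \<le> L2_set (\<lambda>n. norm (a n)) I"
proof -
  obtain N where N: "I \<subseteq> {..<N}"
    using assms finite_nat_set_iff_bounded by (auto simp: subset_eq)
  define b where "b n = (if n \<in> I then a n else 0)" for n
  have "(\<Sum>n<N. s (b n) (e n)) = (\<Sum>n\<in>I. s (a n) (e n))"
    using N by (intro sum.mono_neutral_cong_right) (auto simp: b_def)
  moreover have "L2_set (\<lambda>n. norm (b n)) {..<N} = L2_set (\<lambda>n. norm (a n)) I"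
    unfolding L2_set_def using N
    by (intro arg_cong[of _ _ sqrt] sum.mono_neutral_cong_right) (auto simp: b_def)
  ultimately show ?thesis using upper[of b N] by simp
qed

lemma coord_diff: "coord n (x - y) = coord n x - coord n y"
proof -
  have "coord n (x - y) + coord n y = coord n x"
    by (simp flip: coord_add)
  then show ?thesis by (simp add: eq_diff_eq)
qed

lemma tendsto_coord:
  assumes "(f \<longlongrightarrow> x) F"
  shows "((\<lambda>i. coord n (f i)) \<longlongrightarrow> coord n x) F"
proof (rule Lim_transform_bound[THEN LIM_zero_cancel])
  show "\<forall>\<^sub>F i in F. norm (coord n (f i) - coord n x) \<le> norm (f i - x)"
    by (simp add: coord_le flip: coord_diff)
  show "((\<lambda>i. f i - x) \<longlongrightarrow> 0) F"
    using assms by (rule LIM_zero)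
qed

lemma tendsto_s:
  assumes "(f \<longlongrightarrow> x) F"
  shows "((\<lambda>i. s c (f i)) \<longlongrightarrow> s c x) F"
proof -
  have "((\<lambda>i. norm c * norm (f i - x)) \<longlongrightarrow> norm c * norm (x - x)) F"
    by (intro tendsto_intros assms)
  then have "((\<lambda>i. norm (s c (f i) - s c x)) \<longlongrightarrow> 0) F"
    by (simp add: norm_s flip: scale_right_diff_distrib)
  then show ?thesis
    by (simp add: tendsto_norm_zero_iff LIM_zero_iff)
qed

lemma subspace_closed_span: "subspace closed_span"
proof (rule subspaceI)
  show "0 \<in> closed_span"
    unfolding closed_span_def using closure_subset span_zero by blast
next
  fix x y assume "x \<in> closed_span" "y \<in> closed_span"
  then obtain f g where "\<forall>n. f n \<in> span (range e)" "f \<longlonglongrightarrow> x"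
    and "\<forall>n. g n \<in> span (range e)" "g \<longlonglongrightarrow> y"
    unfolding closed_span_def closure_sequential by blast
  then show "x + y \<in> closed_span"
    unfolding closed_span_def closure_sequential
    by (intro exI[of _ "\<lambda>n. f n + g n"]) (auto intro: tendsto_add span_add)
next
  fix c x assume "x \<in> closed_span"
  then obtain f where "\<forall>n. f n \<in> span (range e)" "f \<longlonglongrightarrow> x"
    unfolding closed_span_def closure_sequential by blast
  then show "s c x \<in> closed_span"
    unfolding closed_span_def closure_sequential
    by (intro exI[of _ "\<lambda>n. s c (f n)"]) (auto intro: tendsto_s span_scale)
qed

lemma e_in_closed_span: "e n \<in> closed_span"
  unfolding closed_span_def by (intro subsetD[OF closure_subset] span_base rangeI)

definition expansion :: "nat \<Rightarrow> 'v \<Rightarrow> 'v"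
  where "expansion N x = (\<Sum>n<N. s (coord n x) (e n))"

lemma expansion_in_closed_span: "expansion N x \<in> closed_span"
  unfolding expansion_def
  by (rule subspace_sum[OF subspace_closed_span])
    (rule subspace_scale[OF subspace_closed_span e_in_closed_span])

lemma expansion_diff: "expansion N (x - y) = expansion N x - expansion N y"
  by (simp only: expansion_def coord_diff scale_left_diff_distrib sum_subtractf)

text \<open>The vectors whose expansions become stationary form a subspace, since two thresholds
  merge into their maximum, and \<open>e m\<close> lies in it with threshold
  \<open>Suc m\<close>.\<close>

lemma span_expansion:
  assumes "x \<in> span (range e)"
  obtains N where "\<And>M. N \<le> M \<Longrightarrow> expansion M x = x"
proof -
  have "\<exists>N. \<forall>M\<ge>N. expansion M x = x"
    using assms
  proof (induction rule: span_induct)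
    case (step x)
    then obtain m where "x = e m" by blast
    moreover have "expansion M (e m) = e m" if "Suc m \<le> M" for M
    proof -
      have "expansion M (e m) = (\<Sum>n<M. if n = m then e n else 0)"
        unfolding expansion_def by (intro sum.cong) (auto simp: coord_e)
      then show ?thesis using that by (simp add: sum.delta)
    qed
    ultimately have "\<forall>M\<ge>Suc m. expansion M x = x" by simp
    then show ?case by (rule exI)
  next
    case base
    show ?case
    proof (rule subspaceI; (intro CollectI)?)
      have "coord n 0 = 0" for n
        using coord_le[of n 0] by simp
      then show "\<exists>N. \<forall>M\<ge>N. expansion M 0 = 0"
        by (simp add: expansion_def)
    next
      fix x y assume "x \<in> {x. \<exists>N. \<forall>M\<ge>N. expansion M x = x}" "y \<in> {x. \<exists>N. \<forall>M\<ge>N. expansion M x = x}"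
      then obtain N N' where *: "\<forall>M\<ge>N. expansion M x = x" "\<forall>M\<ge>N'. expansion M y = y"
        by blast
      have "expansion M (x + y) = expansion M x + expansion M y" for M
        by (simp add: expansion_def coord_add scale_left_distrib sum.distrib)
      with * have "\<forall>M\<ge>max N N'. expansion M (x + y) = x + y"
        by simp
      then show "\<exists>N. \<forall>M\<ge>N. expansion M (x + y) = x + y"
        by (rule exI)
    next
      fix c x assume "x \<in> {x. \<exists>N. \<forall>M\<ge>N. expansion M x = x}"
      then obtain N where "\<forall>M\<ge>N. expansion M x = x" by blast
      moreover have "expansion M (s c x) = s c (expansion M x)" for M
        by (simp add: expansion_def coord_s scale_sum_right)
      ultimately have "\<forall>M\<ge>N. expansion M (s c x) = s c x" by simp
      then show "\<exists>N. \<forall>M\<ge>N. expansion M (s c x) = s c x" by (rule exI)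
    qed
  qed
  then show ?thesis using that by blast
qed

text \<open>For a vector of the algebraic span, a long enough expansion is the vector itself, and
  \<open>lower\<close> applies to it. Only finitely many coordinates occur, each continuous, so the
  bound passes to the closure.\<close>

lemma bessel:
  assumes "x \<in> closed_span"
  shows "L2_set (\<lambda>n. norm (coord n x)) {..<N} \<le> K * norm x"
proof -
  obtain f where f: "\<And>i. f i \<in> span (range e)" "f \<longlonglongrightarrow> x"
    using assms unfolding closed_span_def closure_sequential by blast
  have "L2_set (\<lambda>n. norm (coord n (f i))) {..<N} \<le> K * norm (f i)" for i
  proof -
    obtain N' where N': "\<And>M. N' \<le> M \<Longrightarrow> expansion M (f i) = f i"
      using span_expansion[OF f(1)] by blast
    have "L2_set (\<lambda>n. norm (coord n (f i))) {..<N} \<le> L2_set (\<lambda>n. norm (coord n (f i))) {..<max N N'}"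
      unfolding L2_set_def by (intro real_sqrt_le_mono sum_mono2) auto
    also have "\<dots> \<le> K * norm (expansion (max N N') (f i))"
      unfolding expansion_def by (rule lower)
    finally show ?thesis by (simp add: N')
  qed
  moreover have "(\<lambda>i. L2_set (\<lambda>n. norm (coord n (f i))) {..<N}) \<longlonglongrightarrow> L2_set (\<lambda>n. norm (coord n x)) {..<N}"
    unfolding L2_set_def by (intro tendsto_intros tendsto_coord f)
  moreover have "(\<lambda>i. K * norm (f i)) \<longlonglongrightarrow> K * norm x"
    by (intro tendsto_intros f)
  ultimately show ?thesis
    by (intro tendsto_le[OF sequentially_bot]) auto
qed

text \<open>The coordinates are square summable by \<open>bessel\<close>; the block
  \<open>{m..<Suc m}\<close> isolates a single term. This limit is what defeats normal
  structure.\<close>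

lemma coord_tendsto_0:
  assumes "x \<in> closed_span"
  shows "(\<lambda>n. coord n x) \<longlonglongrightarrow> 0"
proof (rule LIMSEQ_I)
  fix \<epsilon> :: real assume "0 < \<epsilon>"
  then obtain N where N: "\<And>M m. N \<le> m \<Longrightarrow> L2_set (\<lambda>n. norm (coord n x)) {m..<M} < \<epsilon>"
    using L2_set_tail_small[OF bessel[OF assms]] by blast
  have "norm (coord m x) < \<epsilon>" if "N \<le> m" for m
    using N[OF that, of "Suc m"] by (simp add: L2_set_def)
  then show "\<exists>N. \<forall>n\<ge>N. norm (coord n x - 0) < \<epsilon>" by auto
qed

text \<open>By \<open>upper\<close> and \<open>bessel\<close> the expansion operators are bounded by
  \<open>K\<close> on the closed span, uniformly in \<open>N\<close>, and they eventually fix a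
  nearby \<open>y\<close> of the algebraic span. The error is therefore at most \<open>K + 1\<close>
  times the distance to \<open>y\<close>.\<close>

lemma expansion_tendsto:
  assumes "x \<in> closed_span"
  shows "(\<lambda>N. expansion N x) \<longlonglongrightarrow> x"
proof (rule LIMSEQ_I)
  fix \<epsilon> :: real assume "0 < \<epsilon>"
  then have "0 < \<epsilon> / (K + 1)" using K_nonneg by simp
  then obtain y where y: "y \<in> span (range e)" "norm (x - y) < \<epsilon> / (K + 1)"
    using assms unfolding closed_span_def closure_approachable dist_norm
    by (metis norm_minus_commute)
  obtain N where N: "\<And>M. N \<le> M \<Longrightarrow> expansion M y = y"
    using span_expansion[OF y(1)] by blast
  have "x - y \<in> closed_span"
    using assms y(1) closure_subset unfolding closed_span_def[symmetric]
    by (metis closed_span_def subspace_diff subspace_closed_span subsetD)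
  have "norm (expansion M x - x) < \<epsilon>" if "N \<le> M" for M
  proof -
    have "expansion M x - x = expansion M (x - y) - (x - y)"
      using N[OF that] by (simp add: expansion_diff)
    then have "norm (expansion M x - x) \<le> norm (expansion M (x - y)) + norm (x - y)"
      by (metis norm_triangle_ineq4)
    also have "norm (expansion M (x - y)) \<le> K * norm (x - y)"
      unfolding expansion_def by (rule order_trans[OF upper bessel]) fact
    also have "K * norm (x - y) + norm (x - y) = (K + 1) * norm (x - y)"
      by (simp add: algebra_simps)
    also have "\<dots> < \<epsilon>"
      using y(2) K_nonneg by (simp add: pos_less_divide_eq mult.commute)
    finally show ?thesis by simp
  qed
  then show "\<exists>N. \<forall>M\<ge>N. norm (expansion M x - x) < \<epsilon>" by blast
qed

text \<open>The Riesz-Fischer argument: small square norms of the blocks make the partial sums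
  Cauchy.\<close>

lemma series_converges:
  assumes "\<And>N. L2_set (\<lambda>n. norm (a n)) {..<N} \<le> D"
  obtains x where "x \<in> closed_span" "(\<lambda>N. \<Sum>n<N. s (a n) (e n)) \<longlonglongrightarrow> x"
proof -
  let ?S = "\<lambda>N. \<Sum>n<N. s (a n) (e n)"
  have "Cauchy ?S"
  proof (rule CauchyI')
    fix \<epsilon> :: real assume "0 < \<epsilon>"
    then obtain N where N: "\<And>M m. N \<le> m \<Longrightarrow> L2_set (\<lambda>n. norm (a n)) {m..<M} < \<epsilon>"
      using L2_set_tail_small[OF assms] by blast
    have "dist (?S m) (?S M) < \<epsilon>" if "N \<le> m" "m < M" for m M
    proof -
      have "?S M - ?S m = (\<Sum>n\<in>{m..<M}. s (a n) (e n))"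
        using sum_diff_nat_ivl[of 0 m M "\<lambda>n. s (a n) (e n)"] \<open>m < M\<close> by (simp add: lessThan_atLeast0)
      then have "dist (?S M) (?S m) \<le> L2_set (\<lambda>n. norm (a n)) {m..<M}"
        by (simp add: dist_norm norm_sum_le_L2_set)
      then have "dist (?S m) (?S M) \<le> L2_set (\<lambda>n. norm (a n)) {m..<M}"
        by (subst dist_commute)
      then show ?thesis using N[OF \<open>N \<le> m\<close>, of M] by simp
    qed
    then show "\<exists>N. \<forall>m\<ge>N. \<forall>M>m. dist (?S m) (?S M) < \<epsilon>" by blast
  qed
  then obtain x where x: "?S \<longlonglongrightarrow> x"
    using complete unfolding convergent_def by blast
  have "?S N \<in> closed_span" for N
    by (rule subspace_sum[OF subspace_closed_span])
    (rule subspace_scale[OF subspace_closed_span e_in_closed_span])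
  then have "x \<in> closed_span"
    using x unfolding closed_span_def by (rule closed_sequentially[OF closed_closure])
  then show ?thesis using x that by blast
qed

section \<open>Functionals on the closed span and reflexivity\<close>

abbreviation "dual \<equiv> dual_space s norm closed_span"

lemma dual_tendsto:
  assumes "\<phi> \<in> dual" "\<And>i. f i \<in> closed_span" "f \<longlonglongrightarrow> x" "x \<in> closed_span"
  shows "(\<lambda>i. \<phi> (f i)) \<longlonglongrightarrow> \<phi> x"
proof -
  obtain B where B: "\<And>x. x \<in> closed_span \<Longrightarrow> norm (\<phi> x) \<le> B * norm x"
    using assms(1) unfolding dual_space_def by blast
  have diff: "\<phi> (f i) - \<phi> x = \<phi> (f i - x)" for i
  proof -
    have "f i - x \<in> closed_span" using assms subspace_closed_span subspace_diff by blast
    then have "\<phi> (f i - x + x) = \<phi> (f i - x) + \<phi> x"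
      using assms unfolding dual_space_def by blast
    then show ?thesis by simp
  qed
  have "(\<lambda>i. \<phi> (f i) - \<phi> x) \<longlonglongrightarrow> 0"
  proof (rule Lim_null_comparison)
    show "\<forall>\<^sub>F i in sequentially. norm (\<phi> (f i) - \<phi> x) \<le> B * norm (f i - x)"
      unfolding diff using assms subspace_closed_span subspace_diff B by (intro always_eventually) blast
    have "(\<lambda>i. B * norm (f i - x)) \<longlonglongrightarrow> B * norm (x - x)"
      by (intro tendsto_intros assms)
    then show "(\<lambda>i. B * norm (f i - x)) \<longlonglongrightarrow> 0" by simp
  qed
  then show ?thesis by (rule LIM_zero_cancel)
qed

lemma dual_zero: "0 \<in> dual"
  unfolding dual_space_def by (auto intro!: exI[of _ 0])

lemma dual_add:
  assumes "\<phi> \<in> dual" "\<psi> \<in> dual"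
  shows "\<phi> + \<psi> \<in> dual"
proof -
  obtain B B' where "\<forall>x\<in>closed_span. norm (\<phi> x) \<le> B * norm x" "\<forall>x\<in>closed_span. norm (\<psi> x) \<le> B' * norm x"
    using assms unfolding dual_space_def by blast
  then have "\<forall>x\<in>closed_span. norm ((\<phi> + \<psi>) x) \<le> (B + B') * norm x"
    by (auto simp: distrib_right intro!: order_trans[OF norm_triangle_ineq] add_mono)
  then show ?thesis
    using assms unfolding dual_space_def mem_Collect_eq
    by (intro conjI; (rule exI)?) (auto simp: distrib_left add_ac)
qed

lemma dual_scale:
  assumes "\<phi> \<in> dual"
  shows "dual_scale c \<phi> \<in> dual"
proof -
  obtain B where "\<forall>x\<in>closed_span. norm (\<phi> x) \<le> B * norm x"
    using assms unfolding dual_space_def by blast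
  then have "\<forall>x\<in>closed_span. norm (dual_scale c \<phi> x) \<le> (norm c * B) * norm x"
    by (auto simp: dual_scale_def norm_mult mult.assoc intro!: mult_left_mono)
  then show ?thesis
    using assms unfolding dual_space_def mem_Collect_eq
    by (intro conjI; (rule exI)?) (auto simp: dual_scale_def distrib_left mult.left_commute)
qed

lemma dual_sum: "(\<And>i. i \<in> I \<Longrightarrow> \<phi> i \<in> dual) \<Longrightarrow> (\<Sum>i\<in>I. \<phi> i) \<in> dual"
  by (induction I rule: infinite_finite_induct) (simp_all add: dual_zero dual_add)

lemma dual_norm_le:
  assumes "\<And>x. x \<in> closed_span \<Longrightarrow> norm (\<phi> x) \<le> B * norm x" "0 \<le> B"
  shows "dual_norm norm closed_span \<phi> \<le> B"
  unfolding dual_norm_def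
proof (rule cSUP_least)
  show "{x \<in> closed_span. norm x \<le> 1} \<noteq> {}"
    using subspace_0[OF subspace_closed_span] by force
  fix x assume "x \<in> {x \<in> closed_span. norm x \<le> 1}"
  then show "norm (\<phi> x) \<le> B"
    using assms(1)[of x] mult_left_mono[of "norm x" 1 B] assms(2) by auto
qed

text \<open>The cut-off is there because members of \<open>dual_space\<close> vanish off the
  carrier.\<close>

definition cfun :: "nat \<Rightarrow> 'v \<Rightarrow> 'k"
  where "cfun n x = (if x \<in> closed_span then coord n x else 0)"

lemma cfun_in_dual: "cfun n \<in> dual"
  unfolding dual_space_def mem_Collect_eq
proof (intro conjI)
  show "\<exists>B. \<forall>x\<in>closed_span. norm (cfun n x) \<le> B * norm x"
    by (rule exI[of _ 1]) (simp add: cfun_def coord_le)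
qed (simp_all add: cfun_def coord_add coord_s subspace_add[OF subspace_closed_span]
    subspace_scale[OF subspace_closed_span])

text \<open>With \<open>c n = \<phi> (e n)\<close> these are the finite sections that approximate a
  functional \<phi>.\<close>

definition comb :: "(nat \<Rightarrow> 'k) \<Rightarrow> nat \<Rightarrow> 'v \<Rightarrow> 'k"
  where "comb c N = (\<Sum>n<N. dual_scale (c n) (cfun n))"

lemma comb_in_dual: "comb c N \<in> dual"
  unfolding comb_def by (intro dual_sum dual_scale cfun_in_dual)

lemma comb_apply: "x \<in> closed_span \<Longrightarrow> comb c N x = (\<Sum>n<N. c n * coord n x)"
  by (simp only: comb_def sum_fun_apply dual_scale_def cfun_def if_True)

text \<open>The values \<open>a n\<close> of \<Phi> at the coordinate functionals are square
  summable, so they are the coefficients of a convergent series with sum \<open>x\<close>. Both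
  \<Phi> at a functional \<phi> and \<phi> at \<open>x\<close> are limits of the same finite sums of
  \<open>a n * b n\<close>, where \<open>b n = \<phi> (e n)\<close>.\<close>

lemma reflexive_closed_span: "reflexive_space s norm closed_span"
  unfolding reflexive_space_def
proof
  fix \<Phi> assume \<Phi>: "\<Phi> \<in> bidual_space s norm closed_span"
  have \<Phi>_add: "\<Phi> (\<phi> + \<psi>) = \<Phi> \<phi> + \<Phi> \<psi>" if "\<phi> \<in> dual" "\<psi> \<in> dual" for \<phi> \<psi>
    using \<Phi> that unfolding bidual_space_def dual_space_def[of dual_scale] by blast
  have \<Phi>_scale: "\<Phi> (dual_scale c \<phi>) = c * \<Phi> \<phi>" if "\<phi> \<in> dual" for \<phi> c
    using \<Phi> that unfolding bidual_space_def dual_space_def[of dual_scale] by blast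
  obtain B where B: "\<And>\<phi>. \<phi> \<in> dual \<Longrightarrow> norm (\<Phi> \<phi>) \<le> B * dual_norm norm closed_span \<phi>"
    using \<Phi> unfolding bidual_space_def dual_space_def[of dual_scale] by blast
  \<comment> \<open>This replaces the supremum \<open>dual_norm\<close> by any explicit constant
    \<open>C\<close>. As \<open>B\<close> may be negative, its absolute value is taken, which is
    legitimate because the supremum, taken over a set containing 0, is nonnegative.\<close>
  have bound: "norm (\<Phi> \<phi>) \<le> \<bar>B\<bar> * C"
    if "\<phi> \<in> dual" "\<And>x. x \<in> closed_span \<Longrightarrow> norm (\<phi> x) \<le> C * norm x" "0 \<le> C" for \<phi> C
  proof -
    have "norm (\<phi> 0) \<le> dual_norm norm closed_span \<phi>"
      unfolding dual_norm_def
    proof (rule cSUP_upper)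
      show "0 \<in> {x \<in> closed_span. norm x \<le> 1}" using subspace_0[OF subspace_closed_span] by simp
      show "bdd_above ((\<lambda>x. norm (\<phi> x)) ` {x \<in> closed_span. norm x \<le> 1})"
      proof (rule bdd_aboveI2)
        fix x assume "x \<in> {x \<in> closed_span. norm x \<le> 1}"
        then show "norm (\<phi> x) \<le> C"
          using that(2)[of x] mult_left_mono[of "norm x" 1 C] that(3) by auto
      qed
    qed
    then have "0 \<le> dual_norm norm closed_span \<phi>"
      using norm_ge_zero order_trans by blast
    then have "B * dual_norm norm closed_span \<phi> \<le> \<bar>B\<bar> * dual_norm norm closed_span \<phi>"
      by (simp add: mult_right_mono)
    also have "\<dots> \<le> \<bar>B\<bar> * C"
      using dual_norm_le[OF that(2,3)] by (simp add: mult_left_mono)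
    finally show ?thesis using B[OF that(1)] by linarith
  qed
  have "norm (\<Phi> 0) = 0"
    using bound[OF dual_zero, of 0] by simp
  then have \<Phi>_sum: "\<Phi> (\<Sum>i\<in>I. \<phi> i) = (\<Sum>i\<in>I. \<Phi> (\<phi> i))" if "\<And>i. \<phi> i \<in> dual" for \<phi> and I :: "nat set"
    by (induction I rule: infinite_finite_induct)
      (simp_all add: \<Phi>_add dual_sum that del: plus_fun_apply)
  define a where "a n = \<Phi> (cfun n)" for n
  have \<Phi>_comb: "\<Phi> (comb c N) = (\<Sum>n<N. c n * a n)" for c N
    by (simp add: comb_def \<Phi>_sum \<Phi>_scale dual_scale cfun_in_dual a_def)
  \<comment> \<open>\<Phi> is tested on \<open>comb c N\<close>, which Cauchy-Schwarz and
    \<open>bessel\<close> bound by the square norm of \<open>c\<close> times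
    \<open>K\<close>.\<close>
  have "L2_set (\<lambda>n. norm (a n)) {..<N} \<le> \<bar>B\<bar> * K" for N
  proof (rule L2_set_le_of_bounded_pairing)
    fix c :: "nat \<Rightarrow> 'k"
    let ?C = "L2_set (\<lambda>n. norm (c n)) {..<N}"
    have "norm (\<Phi> (comb c N)) \<le> \<bar>B\<bar> * (?C * K)"
    proof (rule bound[OF comb_in_dual])
      fix x assume "x \<in> closed_span"
      then have "norm (comb c N x) \<le> ?C * L2_set (\<lambda>n. norm (coord n x)) {..<N}"
        by (simp add: comb_apply sum_mult_norm_le_L2_set)
      also have "\<dots> \<le> ?C * (K * norm x)"
        using bessel[OF \<open>x \<in> closed_span\<close>] by (intro mult_left_mono) auto
      finally show "norm (comb c N x) \<le> ?C * K * norm x" by (simp add: mult.assoc)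
    qed (simp add: K_nonneg)
    then show "norm (\<Sum>n<N. c n * a n) \<le> \<bar>B\<bar> * K * ?C"
      by (simp add: \<Phi>_comb mult_ac)
  qed (simp add: K_nonneg)
  then obtain x where x: "x \<in> closed_span" "(\<lambda>N. \<Sum>n<N. s (a n) (e n)) \<longlonglongrightarrow> x"
    by (rule series_converges)
  show "\<exists>x\<in>closed_span. \<forall>\<phi>\<in>dual. \<Phi> \<phi> = \<phi> x"
  proof (intro bexI[OF _ \<open>x \<in> closed_span\<close>] ballI)
    fix \<phi> assume \<phi>: "\<phi> \<in> dual"
    then obtain D where D: "\<And>x. x \<in> closed_span \<Longrightarrow> norm (\<phi> x) \<le> D * norm x"
      unfolding dual_space_def by blast
    have \<phi>_add: "\<phi> (x + y) = \<phi> x + \<phi> y" if "x \<in> closed_span" "y \<in> closed_span" for x y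
      using \<phi> that unfolding dual_space_def by blast
    have \<phi>_s: "\<phi> (s c x) = c * \<phi> x" if "x \<in> closed_span" for x c
      using \<phi> that unfolding dual_space_def by blast
    have "\<phi> 0 = 0"
      using D[OF subspace_0[OF subspace_closed_span]] by simp
    define b where "b n = \<phi> (e n)" for n
    have \<phi>_comb: "\<phi> (\<Sum>n\<in>I. s (c n) (e n)) = (\<Sum>n\<in>I. c n * b n)" for c and I :: "nat set"
      by (induction I rule: infinite_finite_induct)
        (simp_all add: \<open>\<phi> 0 = 0\<close> \<phi>_add \<phi>_s e_in_closed_span b_def subspace_closed_span subspace_sum subspace_scale)
    \<comment> \<open>Dually, \<phi> is tested on finite combinations of the \<open>e n\<close>,
      whose norms are controlled by \<open>upper\<close>.\<close>
    have b: "L2_set (\<lambda>n. norm (b n)) {..<N} \<le> \<bar>D\<bar>" for N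
    proof (rule L2_set_le_of_bounded_pairing)
      fix c :: "nat \<Rightarrow> 'k"
      let ?x = "\<Sum>n<N. s (c n) (e n)"
      have "norm (\<phi> ?x) \<le> D * norm ?x"
        by (intro D subspace_sum subspace_scale subspace_closed_span e_in_closed_span)
      also have "\<dots> \<le> \<bar>D\<bar> * norm ?x" by (simp add: mult_right_mono)
      also have "\<dots> \<le> \<bar>D\<bar> * L2_set (\<lambda>n. norm (c n)) {..<N}"
        by (intro mult_left_mono upper) auto
      finally show "norm (\<Sum>n<N. c n * b n) \<le> \<bar>D\<bar> * L2_set (\<lambda>n. norm (c n)) {..<N}"
        by (simp add: \<phi>_comb)
    qed simp
    have "(\<lambda>N. \<Phi> (comb b N)) \<longlonglongrightarrow> \<Phi> \<phi>"
    proof (rule LIMSEQ_I)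
      fix \<epsilon> :: real assume "0 < \<epsilon>"
      \<comment> \<open>The estimate below costs a factor \<open>\<bar>B\<bar> * K\<close>; adding 1
        keeps the denominator positive and the last inequality strict.\<close>
      then have "0 < \<epsilon> / (\<bar>B\<bar> * K + 1)"
        using K_nonneg by (intro divide_pos_pos add_nonneg_pos) auto
      then obtain N where N: "\<And>M m. N \<le> m \<Longrightarrow> L2_set (\<lambda>n. norm (b n)) {m..<M} < \<epsilon> / (\<bar>B\<bar> * K + 1)"
        using L2_set_tail_small[OF b] by blast
      let ?\<delta> = "\<epsilon> / (\<bar>B\<bar> * K + 1)"
      have "norm (\<Phi> (comb b m) - \<Phi> \<phi>) < \<epsilon>" if "N \<le> m" for m
      proof -
        \<comment> \<open>The difference is written as a sum so that additivity and homogeneity of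
          \<Phi> apply to it.\<close>
        let ?\<rho> = "comb b m + dual_scale (- 1) \<phi>"
        have eq: "\<Phi> ?\<rho> = \<Phi> (comb b m) - \<Phi> \<phi>"
          by (simp add: \<Phi>_add comb_in_dual dual_scale \<phi> \<Phi>_scale)
        have "norm (\<Phi> ?\<rho>) \<le> \<bar>B\<bar> * (?\<delta> * K)"
        proof (rule bound)
          show "?\<rho> \<in> dual" by (intro dual_add comb_in_dual dual_scale \<phi>)
          show "0 \<le> ?\<delta> * K" using \<open>0 < ?\<delta>\<close> K_nonneg by (intro mult_nonneg_nonneg) auto
          fix y assume y: "y \<in> closed_span"
          \<comment> \<open>Replacing \<open>y\<close> by its expansion leaves only the block
            \<open>{m..<M}\<close> of the pairing of \<open>b\<close> with the coordinates of
            \<open>y\<close>. Its bound, the tail of \<open>b\<close> against \<open>bessel\<close>,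
            is independent of \<open>M\<close> and survives the limit.\<close>
          have "(\<lambda>M. norm (\<phi> (expansion M y) - comb b m y)) \<longlonglongrightarrow> norm (\<phi> y - comb b m y)"
            by (intro tendsto_intros dual_tendsto[OF \<phi>] expansion_in_closed_span expansion_tendsto y)
          moreover have "norm (\<phi> (expansion M y) - comb b m y) \<le> ?\<delta> * (K * norm y)" if "m \<le> M" for M
          proof -
            have "\<phi> (expansion M y) - comb b m y = (\<Sum>n<M. coord n y * b n) - (\<Sum>n<m. coord n y * b n)"
              using y by (simp add: expansion_def \<phi>_comb comb_apply mult.commute)
            also have "\<dots> = (\<Sum>n\<in>{m..<M}. b n * coord n y)"
              using sum_diff_nat_ivl[of 0 m M "\<lambda>n. b n * coord n y"] \<open>m \<le> M\<close>
              by (simp add: lessThan_atLeast0 mult.commute)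
            also have "norm \<dots> \<le> L2_set (\<lambda>n. norm (b n)) {m..<M} * L2_set (\<lambda>n. norm (coord n y)) {m..<M}"
              by (rule sum_mult_norm_le_L2_set)
            also have "\<dots> \<le> ?\<delta> * (K * norm y)"
            proof (rule mult_mono)
              have "L2_set (\<lambda>n. norm (coord n y)) {m..<M} \<le> L2_set (\<lambda>n. norm (coord n y)) {..<M}"
                unfolding L2_set_def by (intro real_sqrt_le_mono sum_mono2) auto
              also have "\<dots> \<le> K * norm y" by (rule bessel[OF y])
              finally show "L2_set (\<lambda>n. norm (coord n y)) {m..<M} \<le> K * norm y" .
            qed (use N[OF \<open>N \<le> m\<close>, of M] \<open>0 < ?\<delta>\<close> in auto)
            finally show ?thesis .
          qed
          ultimately have "norm (\<phi> y - comb b m y) \<le> ?\<delta> * (K * norm y)"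
            by (intro LIMSEQ_le_const2) auto
          then show "norm (?\<rho> y) \<le> ?\<delta> * K * norm y"
            by (simp add: dual_scale_def norm_minus_commute mult.assoc)
        qed
        also have "\<dots> = (\<bar>B\<bar> * K) * ?\<delta>" by simp
        also have "\<dots> < (\<bar>B\<bar> * K + 1) * ?\<delta>"
          using \<open>0 < ?\<delta>\<close> by (intro mult_strict_right_mono) auto
        also have "\<dots> = \<epsilon>"
          using K_nonneg by (simp add: add_nonneg_pos less_imp_neq[symmetric])
        finally show ?thesis by (simp add: eq)
      qed
      then show "\<exists>N. \<forall>m\<ge>N. norm (\<Phi> (comb b m) - \<Phi> \<phi>) < \<epsilon>" by blast
    qed
    \<comment> \<open>Both sides are the sum of \<open>a n * b n\<close> over
      \<open>n < N\<close>.\<close>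
    moreover have "\<Phi> (comb b N) = \<phi> (\<Sum>n<N. s (a n) (e n))" for N
      by (simp add: \<Phi>_comb \<phi>_comb mult.commute)
    moreover have "(\<lambda>N. \<phi> (\<Sum>n<N. s (a n) (e n))) \<longlonglongrightarrow> \<phi> x"
      by (intro dual_tendsto[OF \<phi>] subspace_sum subspace_scale subspace_closed_span e_in_closed_span x)
    ultimately show "\<Phi> \<phi> = \<phi> x"
      by (simp add: LIMSEQ_unique)
  qed
qed

section \<open>Failure of normal structure\<close>

lemma not_normal_structure:
  assumes "\<And>m n. norm (e m - e n) \<le> 1" "\<And>c x. s (of_real c) x = c *\<^sub>R x"
  shows "\<not> normal_structure closed_span"
proof -
  define C where "C = closure (convex hull (range e))"
  \<comment> \<open>Convexity uses real scalars, the span uses \<open>'k\<close>; the second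
    assumption reconciles them.\<close>
  have "convex (span (range e))"
    by (intro convexI) (simp add: span_add span_scale flip: assms(2))
  then have "convex hull (range e) \<subseteq> span (range e)"
    by (intro hull_minimal) (auto intro: span_base)
  then have "C \<subseteq> closed_span"
    unfolding C_def closed_span_def by (rule closure_mono)
  have e_C: "e n \<in> C" for n
    unfolding C_def by (intro subsetD[OF closure_subset] hull_inc rangeI)
  \<comment> \<open>Balls are closed and convex, so a bound on the distances from \<open>x\<close>
    to the generators extends to \<open>C\<close>. Used first with centre \<open>e n\<close> and
    then with centre in \<open>C\<close>, it bounds all mutual distances in
    \<open>C\<close>.\<close>
  have C_cball: "C \<subseteq> cball x 1" if "\<And>n. norm (x - e n) \<le> 1" for x
    unfolding C_def
    by (intro closure_minimal hull_minimal) (use that in \<open>auto simp: dist_norm\<close>)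
  have C_le: "norm (x - y) \<le> 1" if "x \<in> C" "y \<in> C" for x y
  proof -
    have "norm (x - e n) \<le> 1" for n
      using C_cball[of "e n"] assms(1) \<open>x \<in> C\<close> by (auto simp: dist_norm norm_minus_commute)
    then show ?thesis
      using C_cball[of x] \<open>y \<in> C\<close> by (auto simp: dist_norm)
  qed
  have rad_ge: "1 \<le> rad_at x C" if "x \<in> C" for x
  proof -
    have "norm (x - e n) \<le> rad_at x C" for n
      unfolding rad_at_def using C_le[OF that] by (intro cSUP_upper e_C bdd_aboveI2) auto
    moreover have "norm (coord n x - 1) \<le> norm (x - e n)" for n
      using coord_le[of n "x - e n"] by (simp add: coord_diff coord_e)
    ultimately have "norm (coord n x - 1) \<le> rad_at x C" for n
      using order_trans by blast
    moreover have "(\<lambda>n. norm (coord n x - 1)) \<longlonglongrightarrow> norm (0 - 1 :: 'k)"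
      by (intro tendsto_intros coord_tendsto_0) (use that \<open>C \<subseteq> closed_span\<close> in blast)
    ultimately show ?thesis
      by (intro LIMSEQ_le_const2[where X = "\<lambda>n. norm (coord n x - 1)"]) auto
  qed
  have "1 \<le> rad C"
    unfolding rad_def using e_C rad_ge by (intro cINF_greatest) auto
  have "diam C \<le> 1"
    unfolding diam_def rad_at_def using e_C C_le by (intro cSUP_least) auto
  with \<open>1 \<le> rad C\<close> have "\<not> rad C < diam C" by simp
  moreover have "closedin (top_of_set closed_span) C"
    using \<open>C \<subseteq> closed_span\<close> by (intro closed_subset) (auto simp: C_def)
  moreover have "bounded C"
    using C_cball[of "e 0"] assms(1) bounded_cball bounded_subset by blast
  moreover have "convex C"
    unfolding C_def by (intro convex_closure convex_convex_hull)
  moreover have "\<exists>x\<in>C. \<exists>y\<in>C. x \<noteq> y"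
  proof (rule bexI[OF bexI[OF _ e_C[of 1]] e_C[of 0]])
    show "e 0 \<noteq> e 1"
      using coord_e[of 0 0] coord_e[of 0 1] by auto
  qed
  ultimately show ?thesis
    unfolding normal_structure_def by (intro notI) (drule spec[of _ C], simp)
qed

end

section \<open>Completeness of the space of integrable functions\<close>

text \<open>The sum of the norms has finite integral, so the series converges absolutely almost
  everywhere. Dominated convergence then applies with twice that sum as majorant: once for the
  limit, once for the partial sum.\<close>

lemma suminf_converges_in_mean:
  fixes f :: "nat \<Rightarrow> 'a \<Rightarrow> 'b::{banach, second_countable_topology}"
  assumes f: "\<And>i. integrable M (f i)" and sum: "summable (\<lambda>i. \<integral>x. norm (f i x) \<partial>M)"
  shows "integrable M (\<lambda>x. \<Sum>i. f i x)" (is "integrable M ?S")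
    and "(\<lambda>N. \<integral>x. norm ((\<Sum>i. f i x) - (\<Sum>i<N. f i x)) \<partial>M) \<longlonglongrightarrow> 0"
proof -
  note f[THEN borel_measurable_integrable, measurable]
  have "(\<integral>\<^sup>+x. (\<Sum>i. ennreal (norm (f i x))) \<partial>M) = (\<Sum>i. \<integral>\<^sup>+x. norm (f i x) \<partial>M)"
    by (intro nn_integral_suminf) auto
  also have "\<dots> = (\<Sum>i. ennreal (\<integral>x. norm (f i x) \<partial>M))"
    by (intro arg_cong[where f = suminf] ext nn_integral_eq_integral integrable_norm f) auto
  also have "\<dots> \<noteq> \<infinity>"
    by (simp add: sum ennreal_suminf_neq_top integral_nonneg_AE)
  finally have "AE x in M. (\<Sum>i. ennreal (norm (f i x))) \<noteq> \<infinity>"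
    by (intro nn_integral_noteq_infinite) auto
  then have AE: "AE x in M. summable (\<lambda>i. norm (f i x))"
    by eventually_elim (auto intro: summable_suminf_not_top)
  show S: "integrable M ?S"
    by (rule integrable_suminf[OF f AE sum])
  have w: "integrable M (\<lambda>x. \<Sum>i. norm (f i x))"
    by (rule integrable_suminf) (use f AE sum in auto)
  have "(\<lambda>N. \<integral>x. norm (?S x - (\<Sum>i<N. f i x)) \<partial>M) \<longlonglongrightarrow> (\<integral>x. 0 \<partial>M)"
  proof (rule integral_dominated_convergence)
    show "integrable M (\<lambda>x. 2 * (\<Sum>i. norm (f i x)))"
      using w by simp
    show "AE x in M. (\<lambda>N. norm (?S x - (\<Sum>i<N. f i x))) \<longlonglongrightarrow> 0"
      using AE
    proof eventually_elim
      fix x assume "summable (\<lambda>i. norm (f i x))"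
      then have "(\<lambda>N. \<Sum>i<N. f i x) \<longlonglongrightarrow> ?S x"
        by (rule summable_LIMSEQ[OF summable_norm_cancel])
      then have "(\<lambda>N. norm (?S x - (\<Sum>i<N. f i x))) \<longlonglongrightarrow> norm (?S x - ?S x)"
        by (intro tendsto_intros)
      then show "(\<lambda>N. norm (?S x - (\<Sum>i<N. f i x))) \<longlonglongrightarrow> 0" by simp
    qed
    show "AE x in M. norm (norm (?S x - (\<Sum>i<N. f i x))) \<le> 2 * (\<Sum>i. norm (f i x))" for N
      using AE
    proof eventually_elim
      fix x assume x: "summable (\<lambda>i. norm (f i x))"
      have "norm (?S x - (\<Sum>i<N. f i x)) \<le> norm (?S x) + norm (\<Sum>i<N. f i x)"
        by (rule norm_triangle_ineq4)
      also have "norm (?S x) \<le> (\<Sum>i. norm (f i x))"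
        by (rule summable_norm[OF x])
      also have "norm (\<Sum>i<N. f i x) \<le> (\<Sum>i. norm (f i x))"
        by (rule order_trans[OF norm_sum sum_le_suminf[OF x]]) auto
      finally show "norm (norm (?S x - (\<Sum>i<N. f i x))) \<le> 2 * (\<Sum>i. norm (f i x))" by simp
    qed
  qed (use S in auto)
  then show "(\<lambda>N. \<integral>x. norm (?S x - (\<Sum>i<N. f i x)) \<partial>M) \<longlonglongrightarrow> 0" by simp
qed

text \<open>In the partial quotient \<open>L1_rel\<close> relates only integrable functions, so the
  chosen representative is integrable.\<close>

lemma L1_cases:
  obtains f where "integrable unit_leb f" "X = abs_L1 f"
proof -
  have "L1_rel (rep_L1 X) (rep_L1 X)" "abs_L1 (rep_L1 X) = X"
    using Quotient3_L1 by (auto simp: Quotient3_def)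
  then show ?thesis
    using that[of "rep_L1 X"] by (simp add: L1_rel_def)
qed

lemma L1_rel_refl: "integrable unit_leb f \<Longrightarrow> L1_rel f f"
  by (simp add: L1_rel_def)

lemma sum_abs_L1:
  assumes "\<And>i. i \<in> I \<Longrightarrow> integrable unit_leb (f i)"
  shows "(\<Sum>i\<in>I. abs_L1 (f i)) = abs_L1 (\<lambda>x. \<Sum>i\<in>I. f i x)"
  using assms
  by (induction I rule: infinite_finite_induct)
    (simp_all add: zero_L1_def plus_L1.abs_eq L1_rel_refl)

text \<open>The limit is the class of the pointwise sum of representatives.\<close>

lemma L1_summable:
  fixes Y :: "nat \<Rightarrow> 'a::{banach, second_countable_topology} L1"
  assumes "summable (\<lambda>n. norm (Y n))"
  shows "summable Y"
proof -
  obtain f where f: "\<And>n. integrable unit_leb (f n)" and Y: "\<And>n. Y n = abs_L1 (f n)"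
  proof -
    have "\<exists>g. integrable unit_leb g \<and> Y n = abs_L1 g" for n
      by (rule L1_cases[of "Y n"]) blast
    then show ?thesis using that by metis
  qed
  have "summable (\<lambda>n. \<integral>x. norm (f n x) \<partial>unit_leb)"
    using assms by (simp add: Y norm_L1.abs_eq L1_rel_refl f)
  note conv = suminf_converges_in_mean[OF f this]
  let ?S = "abs_L1 (\<lambda>x. \<Sum>i. f i x)"
  have "norm ((\<Sum>i<N. Y i) - ?S) = (\<integral>x. norm ((\<Sum>i. f i x) - (\<Sum>i<N. f i x)) \<partial>unit_leb)" for N
    by (subst norm_minus_commute)
      (simp add: Y sum_abs_L1 minus_L1.abs_eq norm_L1.abs_eq L1_rel_refl f conv)
  then have "(\<lambda>N. \<Sum>i<N. Y i) \<longlonglongrightarrow> ?S"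
    using conv(2) by - (rule LIM_zero_cancel[OF tendsto_norm_zero_cancel], simp)
  then show ?thesis
    using sums_def summable_def by blast
qed

text \<open>A subsequence with increments at most \<open>(1 / 2) ^ k\<close> is a telescoping,
  absolutely convergent series; a Cauchy sequence with a convergent subsequence converges.\<close>

lemma Cauchy_convergentI_summable:
  fixes X :: "nat \<Rightarrow> 'a::real_normed_vector"
  assumes summable: "\<And>Y :: nat \<Rightarrow> 'a. summable (\<lambda>n. norm (Y n)) \<Longrightarrow> summable Y" and "Cauchy X"
  shows "convergent X"
proof -
  have "\<forall>k. \<exists>N. \<forall>m\<ge>N. \<forall>n\<ge>N. norm (X m - X n) < (1 / 2) ^ k"
    using \<open>Cauchy X\<close> unfolding Cauchy_iff by simp
  then obtain N where N: "\<And>k m n. N k \<le> m \<Longrightarrow> N k \<le> n \<Longrightarrow> norm (X m - X n) < (1 / 2) ^ k"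
    by metis
  \<comment> \<open>The summand \<open>k\<close> makes \<open>r\<close> strictly increasing; the sum
    makes it dominate \<open>N k\<close>.\<close>
  define r where "r k = k + (\<Sum>i\<le>k. N i)" for k
  have "strict_mono r"
    by (auto simp: strict_mono_Suc_iff r_def)
  have r: "N k \<le> r k" for k
    unfolding r_def by (rule trans_le_add2) (rule member_le_sum, auto)
  have "N k \<le> r (Suc k)" for k
    using r[of k] strict_mono_leD[OF \<open>strict_mono r\<close>, of k "Suc k"] by linarith
  then have "norm (X (r (Suc k)) - X (r k)) \<le> (1 / 2) ^ k" for k
    using N[of k "r (Suc k)" "r k"] r[of k] by (simp add: less_imp_le)
  then have "summable (\<lambda>k. norm (X (r (Suc k)) - X (r k)))"
    by (intro summable_comparison_test'[OF summable_geometric[of "1 / 2 :: real"], of 0]) auto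
  then have "summable (\<lambda>k. X (r (Suc k)) - X (r k))"
    by (rule summable)
  then obtain S where "(\<lambda>n. \<Sum>k<n. X (r (Suc k)) - X (r k)) \<longlonglongrightarrow> S"
    unfolding summable_def sums_def by blast
  then have "(\<lambda>n. (X (r n) - X (r 0)) + X (r 0)) \<longlonglongrightarrow> S + X (r 0)"
    unfolding sum_lessThan_telescope[of "\<lambda>k. X (r k)"] by (intro tendsto_intros)
  then have "(X \<circ> r) \<longlonglongrightarrow> S + X (r 0)"
    by (simp add: o_def)
  from Cauchy_converges_subseq[OF \<open>Cauchy X\<close> \<open>strict_mono r\<close> this]
  show ?thesis by (rule convergentI)
qed

lemma L1_Cauchy_convergent:
  fixes X :: "nat \<Rightarrow> 'a::{banach, second_countable_topology} L1"
  shows "Cauchy X \<Longrightarrow> convergent X"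
  by (rule Cauchy_convergentI_summable[OF L1_summable])

section \<open>Rademacher functions\<close>

text \<open>The sign is read off the binary digit of \<open>x\<close> at place \<open>n + 1\<close>.
  Being defined on the whole line, the functions satisfy the doubling and translation identities
  everywhere.\<close>

definition rademacher :: "nat \<Rightarrow> real \<Rightarrow> real"
  where "rademacher n x = (if even \<lfloor>2 ^ Suc n * x\<rfloor> then 1 else - 1)"

lemma rademacher_Suc: "rademacher (Suc n) x = rademacher n (2 * x)"
  by (simp add: rademacher_def mult_ac)

lemma rademacher_add_1: "rademacher n (x + 1) = rademacher n x"
proof -
  have "2 ^ Suc n * (x + 1) = 2 ^ Suc n * x + of_int (2 ^ Suc n)"
    by (simp add: algebra_simps)
  then have "\<lfloor>2 ^ Suc n * (x + 1)\<rfloor> = \<lfloor>2 ^ Suc n * x\<rfloor> + 2 ^ Suc n"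
    by (simp only: floor_add_int)
  then show ?thesis
    by (simp only: rademacher_def) simp
qed

lemma rademacher_0:
  shows "0 \<le> x \<Longrightarrow> x < 1 / 2 \<Longrightarrow> rademacher 0 x = 1"
    and "1 / 2 \<le> x \<Longrightarrow> x < 1 \<Longrightarrow> rademacher 0 x = - 1"
proof -
  show "rademacher 0 x = 1" if "0 \<le> x" "x < 1 / 2"
  proof -
    have "\<lfloor>2 * x\<rfloor> = 0" using that by (intro floor_unique) auto
    then show ?thesis by (simp add: rademacher_def)
  qed
  show "rademacher 0 x = - 1" if "1 / 2 \<le> x" "x < 1"
  proof -
    have "\<lfloor>2 * x\<rfloor> = 1" using that by (intro floor_unique) auto
    then show ?thesis by (simp add: rademacher_def)
  qed
qed

lemma rademacher_cases: "rademacher n x = 1 \<or> rademacher n x = - 1"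
  by (simp add: rademacher_def)

lemma abs_rademacher [simp]: "\<bar>rademacher n x\<bar> = 1"
  by (simp add: rademacher_def)

lemma borel_measurable_rademacher [measurable]: "rademacher n \<in> borel_measurable borel"
  unfolding rademacher_def by measurable

lemma rademacher_sum_Suc:
  fixes a :: "nat \<Rightarrow> 'b::real_vector"
  shows "(\<Sum>k<Suc n. rademacher k x *\<^sub>R a k) =
    rademacher 0 x *\<^sub>R a 0 + (\<Sum>k<n. rademacher k (2 * x) *\<^sub>R a (Suc k))"
  by (simp only: sum.lessThan_Suc_shift rademacher_Suc o_def)

text \<open>On the two halves of the unit interval \<open>rademacher 0\<close> is \<open>1\<close> and \<open>- 1\<close>, and each half is
  mapped affinely onto the unit interval, shifting the remaining Rademacher functions by one.\<close>

lemma has_integral_rademacher_sum_Suc: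
  fixes a :: "nat \<Rightarrow> 'b::real_vector" and F :: "'b \<Rightarrow> real"
  assumes i: "((\<lambda>x. F (a 0 + (\<Sum>k<n. rademacher k x *\<^sub>R a (Suc k)))) has_integral i) {0..1}"
    and j: "((\<lambda>x. F (- a 0 + (\<Sum>k<n. rademacher k x *\<^sub>R a (Suc k)))) has_integral j) {0..1}"
  shows "((\<lambda>x. F (\<Sum>k<Suc n. rademacher k x *\<^sub>R a k)) has_integral (i + j) / 2) {0..1}"
proof -
  let ?R = "\<lambda>x. \<Sum>k<n. rademacher k x *\<^sub>R a (Suc k)"
  have image: "(\<lambda>x::real. (1 / 2) *\<^sub>R x + - ((1 / 2) *\<^sub>R c)) ` cbox 0 1 = {- c / 2..(1 - c) / 2}" for c
    using image_affinity_atLeastAtMost[of "1 / 2" "- c / 2" 0 1] by (simp add: diff_divide_distrib)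
  have "((\<lambda>x. F (a 0 + ?R (2 *\<^sub>R x + 0))) has_integral (1 / \<bar>2\<bar> ^ DIM(real)) *\<^sub>R i)
      ((\<lambda>x. (1 / 2) *\<^sub>R x + - ((1 / 2) *\<^sub>R 0)) ` cbox 0 1)"
    by (rule has_integral_affinity) (use i in simp_all)
  then have "((\<lambda>x. F (a 0 + ?R (2 * x))) has_integral i / 2) {0..1 / 2}"
    unfolding image by simp
  \<comment> \<open>The endpoint \<open>1 / 2\<close> is excepted, since \<open>rademacher 0\<close>
    is already \<open>- 1\<close> there.\<close>
  then have left: "((\<lambda>x. F (\<Sum>k<Suc n. rademacher k x *\<^sub>R a k)) has_integral i / 2) {0..1 / 2}"
    by (rule has_integral_spike_finite[of "{1 / 2}", rotated 2])
      (auto simp del: sum.lessThan_Suc simp: rademacher_sum_Suc rademacher_0)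
  have "((\<lambda>x. F (- a 0 + ?R (2 *\<^sub>R x + - 1))) has_integral (1 / \<bar>2\<bar> ^ DIM(real)) *\<^sub>R j)
      ((\<lambda>x. (1 / 2) *\<^sub>R x + - ((1 / 2) *\<^sub>R - 1)) ` cbox 0 1)"
    by (rule has_integral_affinity) (use j in simp_all)
  then have "((\<lambda>x. F (- a 0 + ?R (2 * x + - 1))) has_integral j / 2) {1 / 2..1}"
    unfolding image by simp
  \<comment> \<open>All Rademacher functions have period 1.\<close>
  moreover have "?R (2 * x + - 1) = ?R (2 * x)" for x
    using rademacher_add_1[of _ "2 * x + - 1"] by simp
  ultimately have "((\<lambda>x. F (- a 0 + ?R (2 * x))) has_integral j / 2) {1 / 2..1}"
    by simp
  \<comment> \<open>The endpoint 1 is excepted, since \<open>rademacher 0\<close> has returned to 1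
    there.\<close>
  then have right: "((\<lambda>x. F (\<Sum>k<Suc n. rademacher k x *\<^sub>R a k)) has_integral j / 2) {1 / 2..1}"
    by (rule has_integral_spike_finite[of "{1}", rotated 2])
      (auto simp del: sum.lessThan_Suc simp: rademacher_sum_Suc rademacher_0)
  show ?thesis
    using has_integral_combine[OF _ _ left right] by (simp add: add_divide_distrib)
qed

text \<open>For every \<open>F\<close> the integrand is a step function. The induction varies
  \<open>F\<close> because each step moves the first coefficient, with either sign, into it.\<close>

lemma integrable_rademacher_sum:
  fixes a :: "nat \<Rightarrow> 'b::real_vector" and F :: "'b \<Rightarrow> real"
  shows "(\<lambda>x. F (\<Sum>k<n. rademacher k x *\<^sub>R a k)) integrable_on {0..1}"
proof (induction n arbitrary: a F)
  case 0
  show ?case by (simp add: integrable_const_ivl)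
next
  case (Suc n)
  show ?case
    using has_integral_rademacher_sum_Suc[OF
        integrable_integral[OF Suc[of "\<lambda>y. F (a 0 + y)" "\<lambda>k. a (Suc k)"]]
        integrable_integral[OF Suc[of "\<lambda>y. F (- a 0 + y)" "\<lambda>k. a (Suc k)"]]]
    by (rule has_integral_integrable)
qed

section \<open>Moments of Rademacher sums and Khintchine's inequality\<close>

definition rademacher_mean :: "nat \<Rightarrow> (nat \<Rightarrow> 'b::real_vector) \<Rightarrow> ('b \<Rightarrow> real) \<Rightarrow> real"
  where "rademacher_mean n a F = integral {0..1} (\<lambda>x. F (\<Sum>k<n. rademacher k x *\<^sub>R a k))"

lemma rademacher_mean_0 [simp]: "rademacher_mean 0 a F = F 0"
  by (simp add: rademacher_mean_def)

lemma rademacher_mean_const [simp]: "rademacher_mean n a (\<lambda>_. c) = c"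
  by (simp add: rademacher_mean_def)

lemma rademacher_mean_add:
  "rademacher_mean n a (\<lambda>y. F y + G y) = rademacher_mean n a F + rademacher_mean n a G"
  unfolding rademacher_mean_def by (intro integral_add integrable_rademacher_sum)

lemma rademacher_mean_mult:
  "rademacher_mean n a (\<lambda>y. c * F y) = c * rademacher_mean n a F"
  unfolding rademacher_mean_def by simp

lemma rademacher_mean_mono:
  "(\<And>y. F y \<le> G y) \<Longrightarrow> rademacher_mean n a F \<le> rademacher_mean n a G"
  unfolding rademacher_mean_def by (intro integral_le integrable_rademacher_sum)

text \<open>Conditioning on the first sign of the random sum. This recursion does the work of
  independence in the moment computations.\<close>

lemma rademacher_mean_Suc:
  "rademacher_mean (Suc n) a F =
    rademacher_mean n (\<lambda>k. a (Suc k)) (\<lambda>y. (1 / 2) * (F (a 0 + y) + F (- a 0 + y)))"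
proof -
  have "rademacher_mean (Suc n) a F =
      (rademacher_mean n (\<lambda>k. a (Suc k)) (\<lambda>y. F (a 0 + y)) +
        rademacher_mean n (\<lambda>k. a (Suc k)) (\<lambda>y. F (- a 0 + y))) / 2"
    unfolding rademacher_mean_def
    by (intro integral_unique has_integral_rademacher_sum_Suc integrable_integral integrable_rademacher_sum)
  also have "\<dots> = (1 / 2) * (rademacher_mean n (\<lambda>k. a (Suc k)) (\<lambda>y. F (a 0 + y)) +
      rademacher_mean n (\<lambda>k. a (Suc k)) (\<lambda>y. F (- a 0 + y)))"
    by simp
  finally show ?thesis
    by (simp only: rademacher_mean_add rademacher_mean_mult)
qed

text \<open>By the parallelogram law, averaging over the first sign cancels the cross term.\<close>

lemma rademacher_second_moment:
  fixes a :: "nat \<Rightarrow> 'b::real_inner"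
  shows "rademacher_mean n a (\<lambda>y. (norm y)\<^sup>2) = (\<Sum>k<n. (norm (a k))\<^sup>2)"
proof (induction n arbitrary: a)
  case (Suc n)
  have "(1 / 2) * ((norm (a 0 + y))\<^sup>2 + (norm (- a 0 + y))\<^sup>2) = (norm (a 0))\<^sup>2 + (norm y)\<^sup>2" for y
    by (simp add: power2_norm_eq_inner inner_simps inner_commute)
  then show ?case
    by (simp only: rademacher_mean_Suc rademacher_mean_add rademacher_mean_const Suc
        sum.lessThan_Suc_shift)
qed simp

text \<open>Averaging the fourth power over the first sign leaves 4 times the squared inner product
  as its only mixed inner-product term, and Cauchy-Schwarz absorbs that. The constant 3 closes the
  induction, as \<open>3 * (?A + ?T)\<^sup>2\<close> supplies exactly the mixed term
  \<open>6 * ?A * ?T\<close>.\<close>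

lemma rademacher_fourth_moment:
  fixes a :: "nat \<Rightarrow> 'b::real_inner"
  shows "rademacher_mean n a (\<lambda>y. (norm y) ^ 4) \<le> 3 * (\<Sum>k<n. (norm (a k))\<^sup>2)\<^sup>2"
proof (induction n arbitrary: a)
  case (Suc n)
  let ?A = "(norm (a 0))\<^sup>2" and ?b = "\<lambda>k. a (Suc k)" and ?T = "\<Sum>k<n. (norm (a (Suc k)))\<^sup>2"
  have step: "(1 / 2) * ((norm (a 0 + y)) ^ 4 + (norm (- a 0 + y)) ^ 4) \<le>
      norm y ^ 4 + (6 * ?A * (norm y)\<^sup>2 + ?A\<^sup>2)" for y
  proof -
    have norm4: "norm v ^ 4 = (v \<bullet> v)\<^sup>2" for v :: 'b
      by (simp add: power2_norm_eq_inner[symmetric])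
    have "(a 0 \<bullet> y)\<^sup>2 \<le> (a 0 \<bullet> a 0) * (y \<bullet> y)"
      by (rule Cauchy_Schwarz_ineq)
    moreover have "(1 / 2) * ((norm (a 0 + y)) ^ 4 + (norm (- a 0 + y)) ^ 4) =
        (a 0 \<bullet> a 0 + y \<bullet> y)\<^sup>2 + 4 * (a 0 \<bullet> y)\<^sup>2"
      unfolding norm4 by (simp add: inner_simps inner_commute power2_eq_square algebra_simps)
    ultimately show ?thesis
      unfolding norm4 power2_norm_eq_inner by (simp add: power2_eq_square algebra_simps)
  qed
  have "rademacher_mean (Suc n) a (\<lambda>y. (norm y) ^ 4) \<le>
      rademacher_mean n ?b (\<lambda>y. norm y ^ 4 + (6 * ?A * (norm y)\<^sup>2 + ?A\<^sup>2))"
    unfolding rademacher_mean_Suc by (intro rademacher_mean_mono step)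
  also have "\<dots> = rademacher_mean n ?b (\<lambda>y. norm y ^ 4) + (6 * ?A * ?T + ?A\<^sup>2)"
    by (simp only: rademacher_mean_add rademacher_mean_mult rademacher_mean_const
        rademacher_second_moment)
  also have "\<dots> \<le> 3 * ?T\<^sup>2 + (6 * ?A * ?T + ?A\<^sup>2)"
    using Suc[of ?b] by simp
  also have "\<dots> \<le> 3 * (?A + ?T)\<^sup>2"
    by (simp add: power2_eq_square algebra_simps)
  finally show ?case
    by (simp add: sum.lessThan_Suc_shift del: sum.lessThan_Suc)
qed simp

text \<open>The variance of the norm is nonnegative, and the second moment is known.\<close>

lemma rademacher_mean_norm_le:
  fixes a :: "nat \<Rightarrow> 'b::real_inner"
  shows "rademacher_mean n a norm \<le> L2_set (\<lambda>k. norm (a k)) {..<n}"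
proof -
  let ?m = "rademacher_mean n a norm"
  have "0 \<le> rademacher_mean n a (\<lambda>y. (norm y - ?m)\<^sup>2)"
    using rademacher_mean_mono[of "\<lambda>_. 0" "\<lambda>y. (norm y - ?m)\<^sup>2" n a] by simp
  also have "(\<lambda>y. (norm (y :: 'b) - ?m)\<^sup>2) = (\<lambda>y. (norm y)\<^sup>2 + ((- 2 * ?m) * norm y + ?m\<^sup>2))"
    by (simp add: power2_eq_square algebra_simps fun_eq_iff)
  also have "rademacher_mean n a \<dots> = (\<Sum>k<n. (norm (a k))\<^sup>2) - ?m\<^sup>2"
    by (simp only: rademacher_mean_add rademacher_mean_mult rademacher_second_moment
        rademacher_mean_const) (simp add: power2_eq_square)
  finally show ?thesis
    unfolding L2_set_def by (intro real_le_rsqrt) simp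
qed

text \<open>Instead of Hoelder's inequality, the bound \<open>3 u\<^sup>2 \<le> 2 u + u\<^sup>4\<close> for \<open>u \<ge> 0\<close> is integrated,
  with \<open>u\<close> half the normalized Rademacher sum.\<close>

lemma khintchine:
  fixes a :: "nat \<Rightarrow> 'b::real_inner"
  shows "L2_set (\<lambda>k. norm (a k)) {..<n} \<le> 2 * rademacher_mean n a norm"
proof -
  let ?\<sigma> = "L2_set (\<lambda>k. norm (a k)) {..<n}" and ?m = "rademacher_mean n a norm"
  have \<sigma>2: "(\<Sum>k<n. (norm (a k))\<^sup>2) = ?\<sigma>\<^sup>2"
    by (simp add: L2_set_def sum_nonneg)
  show ?thesis
  proof (cases "?\<sigma> = 0")
    case True
    then show ?thesis
      using rademacher_mean_mono[of "\<lambda>_. 0" norm n a] by simp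
  next
    case False
    then have "0 < ?\<sigma>" by (simp add: less_le)
    define t where "t = 1 / (2 * ?\<sigma>)"
    have t: "0 < t" "t * ?\<sigma> = 1 / 2"
      using \<open>0 < ?\<sigma>\<close> by (simp_all add: t_def)
    have "3 * t\<^sup>2 * (norm y)\<^sup>2 \<le> 2 * t * norm y + t ^ 4 * norm y ^ 4" for y :: 'b
    proof -
      define u where "u = t * norm y"
      have "0 \<le> u * (u - 1)\<^sup>2 * (u + 2)"
        using t by (auto simp: u_def intro!: mult_nonneg_nonneg add_nonneg_nonneg)
      also have "\<dots> = 2 * u + u ^ 4 - 3 * u\<^sup>2"
        by (simp add: power2_eq_square power4_eq_xxxx algebra_simps)
      finally show ?thesis
        by (simp add: u_def power_mult_distrib mult.assoc)
    qed
    then have "rademacher_mean n a (\<lambda>y. 3 * t\<^sup>2 * (norm y)\<^sup>2) \<le>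
        rademacher_mean n a (\<lambda>y. 2 * t * norm y + t ^ 4 * norm y ^ 4)"
      by (rule rademacher_mean_mono)
    then have "3 * (t * ?\<sigma>)\<^sup>2 \<le> 2 * t * ?m + t ^ 4 * rademacher_mean n a (\<lambda>y. norm y ^ 4)"
      by (simp add: rademacher_mean_add rademacher_mean_mult rademacher_second_moment \<sigma>2
          power_mult_distrib mult.assoc)
    also have "\<dots> \<le> 2 * t * ?m + t ^ 4 * (3 * (?\<sigma>\<^sup>2)\<^sup>2)"
      using rademacher_fourth_moment[of n a] by (intro add_left_mono mult_left_mono) (simp_all add: \<sigma>2)
    also have "\<dots> = 2 * t * ?m + 3 * (t * ?\<sigma>) ^ 4"
      by (simp add: power_mult_distrib)
    \<comment> \<open>This is 3/4 - 3/16. Multiplied by \<open>?\<sigma>\<close> it becomes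
      \<open>9 / 16 * ?\<sigma> \<le> ?m\<close>, and 16/9 is below 2.\<close>
    finally have "9 / 16 \<le> 2 * t * ?m"
      unfolding t(2) by (simp add: power2_eq_square power4_eq_xxxx)
    then have "9 / 16 * ?\<sigma> \<le> 2 * (t * ?\<sigma>) * ?m"
      using mult_right_mono[of "9 / 16" "2 * t * ?m" ?\<sigma>] \<open>0 < ?\<sigma>\<close> by (simp add: mult_ac)
    then show ?thesis
      unfolding t(2) using \<open>0 < ?\<sigma>\<close> by simp
  qed
qed

text \<open>For distinct indices, polarization: the sum of the two functions has second moment 2,
  and its square is 2 plus twice their product.\<close>

lemma integral_rademacher_mult:
  "((\<lambda>x. rademacher m x * rademacher n x) has_integral (if m = n then 1 else 0)) {0..1}"
proof (cases "m = n")
  case True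
  have "rademacher n x * rademacher n x = 1" for x
    using rademacher_cases[of n x] by auto
  then show ?thesis
    using True has_integral_const_real[of "1 :: real" 0 1] by simp
next
  case False
  define a :: "nat \<Rightarrow> real" where "a k = (if k \<in> {m, n} then 1 else 0)" for k
  let ?N = "Suc (max m n)"
  have sum: "(\<Sum>k<?N. f k * a k) = f m + f n" for f
  proof -
    have "(\<Sum>k<?N. f k * a k) = (\<Sum>k\<in>{m, n}. f k)"
      unfolding a_def by (intro sum.mono_neutral_cong_right) auto
    then show ?thesis using False by simp
  qed
  let ?F = "\<lambda>x. (norm (\<Sum>k<?N. rademacher k x *\<^sub>R a k))\<^sup>2"
  have "rademacher_mean ?N a (\<lambda>y. (norm y)\<^sup>2) = 2"
    unfolding rademacher_second_moment using sum[of a]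
    by (simp only: real_norm_def power2_abs) (simp only: power2_eq_square, simp add: a_def)
  then have "(?F has_integral 2) {0..1}"
    using integrable_integral[OF integrable_rademacher_sum[of "\<lambda>y. (norm y)\<^sup>2" a ?N]]
    by (simp only: rademacher_mean_def)
  then have "((\<lambda>x. (1 / 2) * (?F x - 2)) has_integral (1 / 2) * (2 - 2)) {0..1}"
    using has_integral_const_real[of "2 :: real" 0 1]
    by (intro has_integral_mult_right has_integral_diff) auto
  moreover have "(1 / 2) * (?F x - 2) = rademacher m x * rademacher n x" for x
  proof -
    have "?F x = (rademacher m x + rademacher n x)\<^sup>2"
      using sum[of "\<lambda>k. rademacher k x"] by (simp only: real_scaleR_def real_norm_def power2_abs)
    then show ?thesis
      using rademacher_cases[of m x] rademacher_cases[of n x] by auto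
  qed
  ultimately show ?thesis
    using False by simp
qed

section \<open>The span of the Rademacher functions\<close>

lemma borel_measurable_unit_leb: "f \<in> borel_measurable borel \<Longrightarrow> f \<in> borel_measurable unit_leb"
  by (intro measurable_restrict_space1) (simp add: measurable_completion)

lemma integrable_unit_leb_bounded:
  fixes f :: "real \<Rightarrow> 'b::{banach, second_countable_topology}"
  assumes "f \<in> borel_measurable borel" "\<And>x. norm (f x) \<le> B"
  shows "integrable unit_leb f"
proof (rule finite_measure.integrable_const_bound)
  show "finite_measure unit_leb"
    by (rule finite_measure_lebesgue_on) simp
  show "AE x in unit_leb. norm (f x) \<le> B"
    using assms(2) by simp
qed (rule borel_measurable_unit_leb[OF assms(1)])

lift_definition rademacher_L1 ::
    "nat \<Rightarrow> 'k::{real_normed_algebra_1, banach, second_countable_topology} L1"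
  is "\<lambda>n x. of_real (rademacher n x)"
  unfolding L1_rel_def by (auto intro!: integrable_unit_leb_bounded[where B = 1])

lemma integrable_rademacher_scaleR:
  fixes f :: "real \<Rightarrow> 'b::{banach, second_countable_topology}"
  assumes "integrable unit_leb f"
  shows "integrable unit_leb (\<lambda>x. rademacher n x *\<^sub>R f x)"
proof (rule Bochner_Integration.integrable_bound[OF assms])
  have "rademacher n \<in> borel_measurable unit_leb"
    by (rule borel_measurable_unit_leb[OF borel_measurable_rademacher])
  then show "(\<lambda>x. rademacher n x *\<^sub>R f x) \<in> borel_measurable unit_leb"
    using assms by (intro borel_measurable_scaleR) auto
qed simp

text \<open>The Fourier coefficient exists for every integrable \<open>f\<close> because
  \<open>rademacher n\<close> has absolute value 1, which also bounds the functional by the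
  norm.\<close>

lift_definition rademacher_coord ::
    "nat \<Rightarrow> 'k::{real_normed_field, banach, second_countable_topology} L1 \<Rightarrow> 'k"
  is "\<lambda>n f. \<integral>x. rademacher n x *\<^sub>R f x \<partial>unit_leb"
  unfolding L1_rel_def
  by (intro integral_cong_AE) (auto intro!: borel_measurable_integrable integrable_rademacher_scaleR)

text \<open>Passage from the gauge integral, in which the dyadic recursion is carried out, to the
  Lebesgue integral behind the norm of \<open>L1\<close>.\<close>

lemma integral_unit_leb:
  fixes f :: "real \<Rightarrow> 'b::euclidean_space"
  assumes "integrable unit_leb f" "(f has_integral i) {0..1}"
  shows "(\<integral>x. f x \<partial>unit_leb) = i"
  using lebesgue_integral_eq_integral[OF assms(1)] assms(2) by (simp add: integral_unique)

lemma integral_unit_leb_rademacher_mult: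
  shows "integrable unit_leb (\<lambda>x. rademacher m x * rademacher n x)"
    and "(\<integral>x. rademacher m x * rademacher n x \<partial>unit_leb) = (if m = n then 1 else 0)"
proof -
  show "integrable unit_leb (\<lambda>x. rademacher m x * rademacher n x)"
    by (rule integrable_unit_leb_bounded[where B = 1]) (auto simp: abs_mult)
  then show "(\<integral>x. rademacher m x * rademacher n x \<partial>unit_leb) = (if m = n then 1 else 0)"
    by (rule integral_unit_leb) (rule integral_rademacher_mult)
qed

lemma norm_sum_rademacher_L1:
  fixes a :: "nat \<Rightarrow> 'k::{real_normed_field, euclidean_space}"
  shows "norm (\<Sum>n<N. scaleK (a n) (rademacher_L1 n)) = rademacher_mean N a norm"
proof -
  let ?S = "\<lambda>x. \<Sum>n<N. rademacher n x *\<^sub>R a n"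
  have int: "integrable unit_leb (\<lambda>x. of_real (rademacher n x) :: 'k)" for n
    by (auto intro!: integrable_unit_leb_bounded[where B = 1])
  have S: "integrable unit_leb ?S"
  proof (rule integrable_unit_leb_bounded)
    show "norm (?S x) \<le> (\<Sum>n<N. norm (a n))" for x
      by (rule order_trans[OF norm_sum]) simp
  qed measurable
  have "scaleK (a n) (rademacher_L1 n) = abs_L1 (\<lambda>x. rademacher n x *\<^sub>R a n)" for n
    unfolding rademacher_L1_def
    by (simp add: scaleK.abs_eq L1_rel_refl int scaleR_conv_of_real mult.commute)
  then have "(\<Sum>n<N. scaleK (a n) (rademacher_L1 n)) = abs_L1 ?S"
    using int by (simp add: sum_abs_L1 integrable_rademacher_scaleR)
  then have "norm (\<Sum>n<N. scaleK (a n) (rademacher_L1 n)) = (\<integral>x. norm (?S x) \<partial>unit_leb)"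
    using S by (simp add: norm_L1.abs_eq L1_rel_refl)
  also have "\<dots> = rademacher_mean N a norm"
    unfolding rademacher_mean_def
    by (intro integral_unit_leb integrable_integral integrable_rademacher_sum integrable_norm S)
  finally show ?thesis .
qed

text \<open>Two signs differ by 0 or 2 in absolute value, which is 1 minus their product;
  orthogonality gives the integral.\<close>

lemma norm_rademacher_L1_diff:
  "norm (rademacher_L1 m - rademacher_L1 n ::
    'k::{real_normed_algebra_1, banach, second_countable_topology} L1) \<le> 1"
proof transfer
  fix m n
  have "norm (of_real (rademacher m x) - of_real (rademacher n x) :: 'k) =
      1 - rademacher m x * rademacher n x" for x
    using rademacher_cases[of m x] rademacher_cases[of n x]
    by (auto simp flip: of_real_diff simp del: of_real_minus)
  then show "(\<integral>x. norm (of_real (rademacher m x) - of_real (rademacher n x) :: 'k) \<partial>unit_leb) \<le> 1"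
    by (simp add: integral_unit_leb_rademacher_mult measure_restrict_space)
qed

text \<open>The constant 2 is the one from \<open>khintchine\<close>. Scalars in a
  \<open>euclidean_space\<close> carry a real inner product, so the moment estimates cover real and
  complex coefficients alike.\<close>

lemma l2_sequence_rademacher:
  "l2_sequence (scaleK :: 'k::{real_normed_field, euclidean_space} \<Rightarrow> _)
    rademacher_L1 rademacher_coord 2"
proof (intro l2_sequence.intro L1.vector_space_axioms l2_sequence_axioms.intro)
  fix c :: 'k and x y :: "'k L1" and n m N :: nat and a :: "nat \<Rightarrow> 'k" and X :: "nat \<Rightarrow> 'k L1"
  show "norm (scaleK c x) = norm c * norm x"
    by (rule norm_scaleK)
  show "rademacher_coord n (x + y) = rademacher_coord n x + rademacher_coord n y"
    by transfer (simp add: L1_rel_def scaleR_add_right integrable_rademacher_scaleR)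
  show "rademacher_coord n (scaleK c x) = c * rademacher_coord n x"
    by transfer (simp add: L1_rel_def integrable_rademacher_scaleR flip: mult_scaleR_right)
  show "norm (rademacher_coord n x) \<le> norm x"
  proof transfer
    fix n and f :: "real \<Rightarrow> 'k"
    show "norm (\<integral>x. rademacher n x *\<^sub>R f x \<partial>unit_leb) \<le> (\<integral>x. norm (f x) \<partial>unit_leb)"
      using integral_norm_bound[of unit_leb "\<lambda>x. rademacher n x *\<^sub>R f x"] by simp
  qed
  show "rademacher_coord n (rademacher_L1 m :: 'k L1) = (if n = m then 1 else 0)"
  proof transfer
    fix n m
    have "(\<integral>x. rademacher n x *\<^sub>R of_real (rademacher m x) \<partial>unit_leb) =
        (of_real (\<integral>x. rademacher n x * rademacher m x \<partial>unit_leb) :: 'k)"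
      by (simp add: of_real_def integral_unit_leb_rademacher_mult(1))
    then show "(\<integral>x. rademacher n x *\<^sub>R of_real (rademacher m x) \<partial>unit_leb) =
        (if n = m then 1 else 0 :: 'k)"
      by (simp add: integral_unit_leb_rademacher_mult)
  qed
  show "norm (\<Sum>n<N. scaleK (a n) (rademacher_L1 n)) \<le> L2_set (\<lambda>n. norm (a n)) {..<N}"
    unfolding norm_sum_rademacher_L1 by (rule rademacher_mean_norm_le)
  show "L2_set (\<lambda>n. norm (a n)) {..<N} \<le> 2 * norm (\<Sum>n<N. scaleK (a n) (rademacher_L1 n))"
    unfolding norm_sum_rademacher_L1 by (rule khintchine)
  show "Cauchy X \<Longrightarrow> convergent X"
    by (rule L1_Cauchy_convergent)
qed simp

lemma reflexive_subspace_without_normal_structure: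
  "\<exists>X :: 'k::{real_normed_field, euclidean_space} L1 set. L1.subspace X \<and> closed X \<and>
    reflexive_space scaleK norm X \<and> \<not> normal_structure X"
proof -
  interpret R: l2_sequence "scaleK :: 'k \<Rightarrow> _" rademacher_L1 rademacher_coord 2
    by (rule l2_sequence_rademacher)
  have "closed R.closed_span"
    by (simp add: R.closed_span_def)
  moreover have "\<not> normal_structure R.closed_span"
    by (rule R.not_normal_structure) (simp_all add: norm_rademacher_L1_diff scaleK_of_real)
  ultimately show ?thesis
    using R.subspace_closed_span R.reflexive_closed_span by blast
qed

theorem mainTheorem4:
  "(\<exists>X :: real L1 set. L1.subspace X \<and> closed X \<and>
      reflexive_space scaleK norm X \<and> \<not> normal_structure X) \<and>
   (\<exists>X :: complex L1 set. L1.subspace X \<and> closed X \<and>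
      reflexive_space scaleK norm X \<and> \<not> normal_structure X)"
  by (intro conjI reflexive_subspace_without_normal_structure)

end
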